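(* Consider the standard action of Thompson's group $F$ on $[0,1]$. Suppose we are given four pairwise disjoint closed dyadic subintervals $I_i=[p_i,q_i]\subseteq[0,1]$, $1\le i\le4$, and assume that $p_1<p_2<p_3<p_4$. For any non-trivial $h_1\in F_{I_1}$, $h_2\in F_{I_2}$, $h_3\in F_{I_3}$ and $h_4\in F_{I_4}$, let $$w_{14}=[h_1^{y},h_4]=y^{-1}h_1^{-1}yh_4^{-1}y^{-1}h_1yh_4,$$ $$w_{23}=[h_2^{y},h_3]=y^{-1}h_2^{-1}yh_3^{-1}y^{-1}h_2yh_3.$$ Then the word $w$ obtained from $[w_{14},w_{23}]$ by reduction in $\mathbb{Z}\ast F$ (where the variable $y$ is treated as a generator of $\mathbb{Z}$) is a law with constants in $F$.
   Context: Thompson's group $F$ is the group, under composition, of all strictly increasing continuous piecewise-linear functions from $[0,1]$ onto itself which are differentiable except at finitely many dyadic rationals and all of whose slopes are integer powers of $2$; it acts on $[0,1]$ on the left. A dyadic interval is a non-degenerate interval whose endpoints are dyadic rationals. For a dyadic interval $[a,b]\subseteq[0,1]$, $F_{[a,b]}$ is the subgroup of elements of $F$ which are trivial on the complement of $[a,b]$. Conventions: $h^y=y^{-1}hy$ and $[a,b]=a^{-1}b^{-1}ab$. A law with constants in a group $G$ is a non-trivial word $w(y_1,\ldots,y_t)$ over $G$, reduced in $\mathbb{F}_t\ast G$ ($\mathbb{F}_t$ free on $y_1,\ldots,y_t$), containing at least one variable and at least one constant, such that $w(\bar g)=1$ for every $\bar g\in G^t$. *)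

theory Defs
  imports "HOL-Analysis.Analysis" "HOL-Algebra.Bij"
begin

section \<open>Thompson's group F\<close>

definition dyadic :: "real set" where
  "dyadic = {x. \<exists>(m::int) (n::nat). x = of_int m / 2 ^ n}"

text \<open>Between consecutive points of the finite set \<open>P\<close> the function is affine.\<close>

definition piecewise_linear_on :: "real set \<Rightarrow> (real \<Rightarrow> real) \<Rightarrow> bool" where
  "piecewise_linear_on S f \<longleftrightarrow>
     (\<exists>P. finite P \<and>
        (\<forall>a b. {a<..<b} \<subseteq> S - P \<longrightarrow> (\<exists>c d. \<forall>x\<in>{a<..<b}. f x = c * x + d)))"

text \<open>
  Elements are extensional functions on \<open>[0,1]\<close> (undefined outside), and the group is a
  substructure of the group of all bijections of \<open>[0,1]\<close>; the product \<open>f \<otimes> g\<close> is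
  \<open>x \<mapsto> f (g x)\<close>, in accordance with a left action. At the endpoints \<open>0\<close> and \<open>1\<close>,
  differentiability is one-sided.
\<close>

definition thompson_F :: "(real \<Rightarrow> real) monoid" where
  "thompson_F = (BijGroup {0..1}) \<lparr> carrier :=
     {f \<in> extensional {0..1}.
        f ` {0..1} = {0..1} \<and> strict_mono_on {0..1} f \<and> continuous_on {0..1} f \<and>
        piecewise_linear_on {0..1} f \<and>
        (\<exists>D. finite D \<and> D \<subseteq> dyadic \<and>
           (\<forall>x\<in>{0..1} - D. \<exists>k::int.
              (f has_real_derivative 2 powi k) (at x within {0..1})))} \<rparr>"

definition thompson_F_on :: "real set \<Rightarrow> (real \<Rightarrow> real) set" where
  "thompson_F_on I = {f \<in> carrier thompson_F. \<forall>x\<in>{0..1} - I. f x = x}"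

section \<open>Words with constants\<close>

text \<open>
  \<open>Var i True\<close> stands for \<open>y\<^sub>i\<close> and \<open>Var i False\<close> for its inverse; variables are
  numbered from \<open>0\<close>, so words in \<open>t\<close> variables use the indices below \<open>t\<close>.
\<close>

datatype 'a letter = Const 'a | Var nat bool

type_synonym 'a cword = "'a letter list"

definition cwords :: "('a, 'b) monoid_scheme \<Rightarrow> nat \<Rightarrow> 'a cword set" where
  "cwords G t = lists (Const ` carrier G \<union> {Var i e | i e. i < t})"

fun letter_inv :: "('a, 'b) monoid_scheme \<Rightarrow> 'a letter \<Rightarrow> 'a letter" where
  "letter_inv G (Const g) = Const (inv\<^bsub>G\<^esub> g)"
| "letter_inv G (Var i e) = Var i (\<not> e)"

definition word_inv :: "('a, 'b) monoid_scheme \<Rightarrow> 'a cword \<Rightarrow> 'a cword" where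
  "word_inv G w = rev (map (letter_inv G) w)"

definition word_conj :: "('a, 'b) monoid_scheme \<Rightarrow> 'a cword \<Rightarrow> 'a cword \<Rightarrow> 'a cword" where
  "word_conj G u v = word_inv G v @ u @ v"

definition word_comm :: "('a, 'b) monoid_scheme \<Rightarrow> 'a cword \<Rightarrow> 'a cword \<Rightarrow> 'a cword" where
  "word_comm G u v = word_inv G u @ word_inv G v @ u @ v"

fun letter_val :: "('a, 'b) monoid_scheme \<Rightarrow> (nat \<Rightarrow> 'a) \<Rightarrow> 'a letter \<Rightarrow> 'a" where
  "letter_val G \<rho> (Const g) = g"
| "letter_val G \<rho> (Var i e) = (if e then \<rho> i else inv\<^bsub>G\<^esub> (\<rho> i))"

definition word_val :: "('a, 'b) monoid_scheme \<Rightarrow> (nat \<Rightarrow> 'a) \<Rightarrow> 'a cword \<Rightarrow> 'a" where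
  "word_val G \<rho> w = foldr (\<lambda>l a. letter_val G \<rho> l \<otimes>\<^bsub>G\<^esub> a) w \<one>\<^bsub>G\<^esub>"

section \<open>Reduction in the free product of a free group and G\<close>

fun reducible_pair :: "'a letter \<Rightarrow> 'a letter \<Rightarrow> bool" where
  "reducible_pair (Const g) (Const h) = True"
| "reducible_pair (Var i d) (Var j e) = (i = j \<and> d \<noteq> e)"
| "reducible_pair _ _ = False"

definition reduced :: "('a, 'b) monoid_scheme \<Rightarrow> 'a cword \<Rightarrow> bool" where
  "reduced G w \<longleftrightarrow>
     Const \<one>\<^bsub>G\<^esub> \<notin> set w \<and> successively (\<lambda>l m. \<not> reducible_pair l m) w"

inductive red_step :: "('a, 'b) monoid_scheme \<Rightarrow> 'a cword \<Rightarrow> 'a cword \<Rightarrow> bool" for G where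
  one: "red_step G (u @ [Const \<one>\<^bsub>G\<^esub>] @ v) (u @ v)"
| mult: "red_step G (u @ [Const g, Const h] @ v) (u @ [Const (g \<otimes>\<^bsub>G\<^esub> h)] @ v)"
| cancel: "red_step G (u @ [Var i e, Var i (\<not> e)] @ v) (u @ v)"

text \<open>
  \<open>reduce\<close> computes the normal form for \<open>red_step\<close>; see \<open>reduced_reduce\<close> and
  \<open>red_steps_reduce\<close> below. In \<open>prepend G l w\<close> the word \<open>w\<close> is already reduced.
\<close>

fun prepend :: "('a, 'b) monoid_scheme \<Rightarrow> 'a letter \<Rightarrow> 'a cword \<Rightarrow> 'a cword" where
  "prepend G (Const g) w =
     (if g = \<one>\<^bsub>G\<^esub> then w
      else case w of
        Const h # v \<Rightarrow>
          (if g \<otimes>\<^bsub>G\<^esub> h = \<one>\<^bsub>G\<^esub> then v else Const (g \<otimes>\<^bsub>G\<^esub> h) # v)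
      | _ \<Rightarrow> Const g # w)"
| "prepend G (Var i e) w =
     (case w of
        Var j d # v \<Rightarrow> (if i = j \<and> d \<noteq> e then v else Var i e # w)
      | _ \<Rightarrow> Var i e # w)"

definition reduce :: "('a, 'b) monoid_scheme \<Rightarrow> 'a cword \<Rightarrow> 'a cword" where
  "reduce G w = foldr (prepend G) w []"

lemma reduced_prepend:
  assumes "reduced G w"
  shows "reduced G (prepend G l w)"
  using assms
  by (cases l; cases w rule: remdups_adj.cases)
     (auto simp: reduced_def split: letter.splits elim: reducible_pair.elims)

lemma reduced_reduce: "reduced G (reduce G w)"
  unfolding reduce_def
  by (induction w) (simp add: reduced_def, simp add: reduced_prepend)

lemma red_step_Cons: "red_step G v w \<Longrightarrow> red_step G (l # v) (l # w)"
  by (induction rule: red_step.induct) (metis append_Cons red_step.intros)+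

lemma red_steps_Cons: "(red_step G)\<^sup>*\<^sup>* v w \<Longrightarrow> (red_step G)\<^sup>*\<^sup>* (l # v) (l # w)"
  by (induction rule: rtranclp_induct) (auto intro: red_step_Cons rtranclp.rtrancl_into_rtrancl)

lemma red_steps_prepend: "(red_step G)\<^sup>*\<^sup>* (l # w) (prepend G l w)"
proof -
  have 1: "red_step G (Const \<one>\<^bsub>G\<^esub> # v) v" for v
    using red_step.one[of G "[]" v] by simp
  have 2: "red_step G (Const g # Const h # v) (Const (g \<otimes>\<^bsub>G\<^esub> h) # v)" for g h v
    using red_step.mult[of G "[]" g h v] by simp
  have 3: "red_step G (Var i e # Var i d # v) v" if "d \<noteq> e" for i d e v
    using red_step.cancel[of G "[]" i e v] that by (cases e; cases d) auto
  have 4: "(red_step G)\<^sup>*\<^sup>* (Const g # Const h # v) v" if "g \<otimes>\<^bsub>G\<^esub> h = \<one>\<^bsub>G\<^esub>" for g h v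
    using 2[of g h v] 1[of v] that by (metis converse_rtranclp_into_rtranclp r_into_rtranclp)
  show ?thesis
    by (cases l) (auto split: list.splits letter.splits intro: 1 2 3 4 r_into_rtranclp)
qed

lemma red_steps_reduce: "(red_step G)\<^sup>*\<^sup>* w (reduce G w)"
proof (induction w)
  case Nil
  show ?case by (simp add: reduce_def)
next
  case (Cons l w)
  have "(red_step G)\<^sup>*\<^sup>* (l # w) (l # reduce G w)"
    using Cons by (rule red_steps_Cons)
  also have "(red_step G)\<^sup>*\<^sup>* (l # reduce G w) (prepend G l (reduce G w))"
    by (rule red_steps_prepend)
  finally show ?case by (simp add: reduce_def)
qed

section \<open>Laws with constants\<close>

definition law_with_constants :: "('a, 'b) monoid_scheme \<Rightarrow> nat \<Rightarrow> 'a cword \<Rightarrow> bool" where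
  "law_with_constants G t w \<longleftrightarrow>
     w \<in> cwords G t \<and> w \<noteq> [] \<and> reduced G w \<and>
     (\<exists>i e. Var i e \<in> set w) \<and> (\<exists>g. Const g \<in> set w) \<and>
     (\<forall>\<rho>. (\<forall>i<t. \<rho> i \<in> carrier G) \<longrightarrow> word_val G \<rho> w = \<one>\<^bsub>G\<^esub>)"

lemma word_comm_conj_letters:
  "word_comm G (word_conj G [Const a] [Var i True]) [Const b] =
     [Var i False, Const (inv\<^bsub>G\<^esub> a), Var i True, Const (inv\<^bsub>G\<^esub> b),
      Var i False, Const a, Var i True, Const b]"
  by (simp add: word_comm_def word_conj_def word_inv_def)

end

theory Submission
  imports Defs
begin

text \<open>
  If the value of \<open>w\<^sub>1\<^sub>4\<close> at \<open>g\<close> is nontrivial, then \<open>h\<^sub>1\<^sup>g\<close>, which is supported in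
  \<open>g\<^sup>-\<^sup>1(I\<^sub>1)\<close>, does not commute with \<open>h\<^sub>4\<close>, so \<open>g\<close> maps a point \<open>a\<close> of \<open>I\<^sub>4\<close> into \<open>I\<^sub>1\<close>.
  Likewise, if the value of \<open>w\<^sub>2\<^sub>3\<close> is nontrivial, then \<open>g\<close> maps a point \<open>b\<close> of \<open>I\<^sub>3\<close> into
  \<open>I\<^sub>2\<close>. Both cannot happen, since \<open>b < a\<close> and \<open>g(a) < g(b)\<close>, while \<open>g\<close> is increasing. Hence
  one of the two values is trivial, and so is their commutator.
\<close>

section \<open>Functions with dyadic slopes\<close>

lemma dyadic_add: "x \<in> dyadic \<Longrightarrow> y \<in> dyadic \<Longrightarrow> x + y \<in> dyadic"
proof -
  assume "x \<in> dyadic" "y \<in> dyadic"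
  then obtain m n :: int and k l :: nat where "x = m / 2 ^ k" "y = n / 2 ^ l"
    by (auto simp: dyadic_def)
  then have "x + y = of_int (m * 2 ^ l + n * 2 ^ k) / 2 ^ (k + l)"
    by (simp add: add_divide_distrib power_add)
  then show ?thesis unfolding dyadic_def by blast
qed

lemma dyadic_powi_mult: "x \<in> dyadic \<Longrightarrow> 2 powi k * x \<in> dyadic"
proof -
  assume "x \<in> dyadic"
  then obtain m :: int and n :: nat where x: "x = m / 2 ^ n"
    by (auto simp: dyadic_def)
  show ?thesis
  proof (cases "0 \<le> k")
    case True
    then have "2 powi k * x = of_int (2 ^ nat k * m) / 2 ^ n"
      by (simp add: x power_int_def)
    then show ?thesis unfolding dyadic_def by blast
  next
    case False
    then have "2 powi k * x = of_int m / 2 ^ (n + nat (- k))"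
      by (simp add: x power_int_def power_add power_inverse field_simps)
    then show ?thesis unfolding dyadic_def by blast
  qed
qed

lemma dyadic_powi_mult_iff: "2 powi k * x \<in> dyadic \<longleftrightarrow> x \<in> dyadic"
proof
  assume "2 powi k * x \<in> dyadic"
  then have "2 powi (- k) * (2 powi k * x) \<in> dyadic" by (rule dyadic_powi_mult)
  then show "x \<in> dyadic" by (simp add: power_int_minus flip: mult.assoc)
qed (rule dyadic_powi_mult)

text \<open>Together with \<open>dyadic_powi_mult_iff\<close> this shows that an affine map whose
  slope is a power of 2 and which sends one dyadic point to a dyadic point both preserves and
  reflects dyadicity.\<close>

lemma dyadic_add_iff: "x \<in> dyadic \<Longrightarrow> x + y \<in> dyadic \<longleftrightarrow> y \<in> dyadic"
proof
  assume "x \<in> dyadic" "x + y \<in> dyadic"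
  moreover have "- x \<in> dyadic"
    using \<open>x \<in> dyadic\<close> unfolding dyadic_def
    by clarsimp (metis minus_divide_left of_int_minus)
  ultimately show "y \<in> dyadic" using dyadic_add[of "- x" "x + y"] by simp
qed (rule dyadic_add)

text \<open>The slope condition of \<open>thompson_F\<close> with its exceptional set as a
  parameter, so that breakpoints can be tracked through composition and inversion. Finiteness and
  dyadicity of \<open>D\<close> stay outside, since being affine on an interval only depends on
  \<open>D\<close> missing that interval.\<close>

definition dyadic_slopes :: "real set \<Rightarrow> (real \<Rightarrow> real) \<Rightarrow> bool" where
  "dyadic_slopes D f \<longleftrightarrow>
     (\<forall>x\<in>{0..1} - D. \<exists>k::int. (f has_real_derivative 2 powi k) (at x within {0..1}))"

text \<open>The slope of the chord over \<open>[a,x]\<close> depends continuously on \<open>x\<close> and, by the mean value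
  theorem, takes values in the discrete set of powers of 2, so it is constant.\<close>

lemma dyadic_slopes_affine:
  fixes f :: "real \<Rightarrow> real"
  assumes "dyadic_slopes D f" and cont: "continuous_on {0..1} f"
    and "0 \<le> a" "a < b" "b \<le> 1" and D: "{a<..<b} \<inter> D = {}"
  obtains k :: int where "\<And>x. x \<in> {a..b} \<Longrightarrow> f x = f a + 2 powi k * (x - a)"
proof -
  define s where "s x = (f x - f a) / (x - a)" for x
  have slope: "\<exists>k::int. s x = 2 powi k" if x: "x \<in> {a<..b}" for x
  proof -
    have der: "\<exists>k::int. (f has_real_derivative 2 powi k) (at z)" if "a < z" "z < x" for z
    proof -
      have "z \<in> {0..1} - D" using that x assms(3-6) by (auto simp: disjoint_iff)
      then obtain k :: int where "(f has_real_derivative 2 powi k) (at z within {0..1})"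
        using assms(1) unfolding dyadic_slopes_def by blast
      \<comment> \<open>Points strictly between \<open>a\<close> and \<open>x\<close> are interior
        to the unit interval, so the derivative relative to it is the two-sided one that the mean
        value theorem asks for.\<close>
      moreover have "at z within {0..1} = at z"
        using that x assms by (intro at_within_interior) (auto simp: interior_atLeastAtMost_real)
      ultimately show ?thesis by auto
    qed
    have "continuous_on {a..x} f"
      using cont x assms by (auto elim: continuous_on_subset)
    moreover have "f differentiable (at z)" if "a < z" "z < x" for z
      using der[OF that] real_differentiable_def by blast
    ultimately obtain l z where "a < z" "z < x" and l: "DERIV f z :> l" "f x - f a = (x - a) * l"
      using MVT[of a x f] x by auto
    moreover obtain k :: int where "(f has_real_derivative 2 powi k) (at z)"
      using der \<open>a < z\<close> \<open>z < x\<close> by blast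
    ultimately have "l = 2 powi k" by (meson DERIV_unique)
    then have "s x = 2 powi k" using l(2) x by (auto simp: s_def)
    then show ?thesis ..
  qed
  have log: "\<exists>k::int. log 2 (s x) = k" if x: "x \<in> {a<..b}" for x
  proof -
    obtain k :: int where "s x = 2 powi k" using slope[OF x] by blast
    then have "s x = 2 powr k" by (simp add: powr_real_of_int')
    then show ?thesis by auto
  qed
  have pos: "0 < s x" if "x \<in> {a<..b}" for x
    using slope[OF that] by auto
  \<comment> \<open>Taking logarithms turns powers of 2 into integers, so the gap 1 works at every
    point. The interval is open at \<open>a\<close>, where \<open>s\<close> is 0 by division by zero
    and not a slope.\<close>
  have "(\<lambda>x. log 2 (s x)) constant_on {a<..b}"
  proof (rule continuous_discrete_range_constant)
    have "continuous_on {a<..b} f"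
      using cont assms by (auto elim: continuous_on_subset)
    then have "continuous_on {a<..b} s"
      unfolding s_def by (intro continuous_intros) auto
    then show "continuous_on {a<..b} (\<lambda>x. log 2 (s x))"
      using pos by (intro continuous_intros) (auto simp: less_imp_neq[THEN not_sym] less_imp_le)
  next
    fix x assume "x \<in> {a<..b}"
    then have "1 \<le> norm (log 2 (s y) - log 2 (s x))"
      if y: "y \<in> {a<..b}" "log 2 (s y) \<noteq> log 2 (s x)" for y
    proof -
      obtain k l :: int where kl: "log 2 (s y) = k" "log 2 (s x) = l"
        using log[OF y(1)] log[OF \<open>x \<in> {a<..b}\<close>] by blast
      then have "1 \<le> \<bar>k - l\<bar>" using y(2) by auto
      then show ?thesis unfolding kl by (metis of_int_1_le_iff of_int_abs of_int_diff real_norm_def)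
    qed
    then show "\<exists>e>0. \<forall>y. y \<in> {a<..b} \<and> log 2 (s y) \<noteq> log 2 (s x) \<longrightarrow>
        e \<le> norm (log 2 (s y) - log 2 (s x))"
      by (intro exI[of _ 1]) auto
  qed simp
  then obtain c where c: "\<And>x. x \<in> {a<..b} \<Longrightarrow> log 2 (s x) = c"
    unfolding constant_on_def by blast
  have eq: "s x = s b" if "x \<in> {a<..b}" for x
  proof -
    have b: "b \<in> {a<..b}" using assms by auto
    have "s x = 2 powr log 2 (s x)" using pos[OF that] by simp
    also have "\<dots> = 2 powr log 2 (s b)" using c[OF that] c[OF b] by (simp only:)
    also have "\<dots> = s b" using pos[OF b] by simp
    finally show ?thesis .
  qed
  obtain k :: int where "s b = 2 powi k" using slope[of b] assms by auto
  then have "f x = f a + 2 powi k * (x - a)" if "x \<in> {a..b}" for x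
    using eq[of x] that by (cases "x = a") (auto simp: s_def field_simps)
  then show ?thesis by (rule that)
qed

text \<open>Makes \<open>piecewise_linear_on\<close> a consequence of the slope condition, with the
  same breakpoints, so closure proofs need not treat it separately.\<close>

lemma dyadic_slopes_piecewise_linear:
  assumes "dyadic_slopes D f" "continuous_on {0..1} f" "finite D"
  shows "piecewise_linear_on {0..1} f"
  unfolding piecewise_linear_on_def
proof (intro exI[of _ D] conjI allI impI)
  fix a b :: real assume ab: "{a<..<b} \<subseteq> {0..1} - D"
  show "\<exists>c d. \<forall>x\<in>{a<..<b}. f x = c * x + d"
  \<comment> \<open>An empty interval says nothing about where \<open>a\<close> and \<open>b\<close>
    lie, but then any coefficients do.\<close>
  proof (cases "a < b")
    case True
    then have "0 \<le> a" "b \<le> 1"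
      using ab greaterThanLessThan_subseteq_atLeastAtMost_iff[of a b 0 1] by auto
    then obtain k :: int where "\<And>x. x \<in> {a..b} \<Longrightarrow> f x = f a + 2 powi k * (x - a)"
      using dyadic_slopes_affine[OF assms(1,2), of a b] True ab by blast
    then show ?thesis
      by (intro exI[of _ "2 powi k"] exI[of _ "f a - 2 powi k * a"]) (auto simp: algebra_simps)
  qed auto
qed fact

text \<open>Starting from 0, dyadicity of the value is carried from one breakpoint to the next,
  because \<open>f\<close> is affine in between with a power of 2 as slope. This keeps the
  breakpoints of composites and inverses dyadic.\<close>

lemma dyadic_slopes_dyadic_iff:
  fixes f :: "real \<Rightarrow> real"
  assumes "dyadic_slopes D f" "continuous_on {0..1} f" "finite D" "D \<subseteq> dyadic" "f 0 = 0"
    and "x \<in> {0..1}"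
  shows "f x \<in> dyadic \<longleftrightarrow> x \<in> dyadic"
  using assms(6)
proof (induction "card (D \<inter> {0<..<x})" arbitrary: x rule: less_induct)
  case less
  have zero: "0 \<in> dyadic" unfolding dyadic_def by force
  show ?case
  proof (cases "x = 0")
    case True
    then show ?thesis using assms(5) zero by simp
  next
    case False
    \<comment> \<open>The maximum of \<open>S\<close> is the last breakpoint before
      \<open>x\<close>, or 0 if there is none, so that \<open>f\<close> is affine from there to
      \<open>x\<close>.\<close>
    define S where "S = insert 0 (D \<inter> {0<..<x})"
    define a where "a = Max S"
    have S: "finite S" "S \<noteq> {}" unfolding S_def using assms(3) by auto
    have "a \<in> S" unfolding a_def using S by (rule Max_in)
    then have a: "0 \<le> a" "a < x" unfolding S_def using less.prems False by auto
    have D: "{a<..<x} \<inter> D = {}"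
    proof (rule ccontr)
      assume "{a<..<x} \<inter> D \<noteq> {}"
      then obtain z where "a < z" "z < x" "z \<in> D" by auto
      then have "z \<in> S" unfolding S_def using a by auto
      then have "z \<le> a" unfolding a_def using S(1) by simp
      with \<open>a < z\<close> show False by simp
    qed
    have fa: "a \<in> dyadic \<and> f a \<in> dyadic"
    proof (cases "a = 0")
      case True
      then show ?thesis using assms(5) zero by simp
    next
      case False
      then have "a \<in> D" "0 < a" using \<open>a \<in> S\<close> unfolding S_def by auto
      \<comment> \<open>The point \<open>a\<close> itself is counted for \<open>x\<close> but not
        for \<open>a\<close>, so the induction measure drops.\<close>
      then have "D \<inter> {0<..<a} \<subset> D \<inter> {0<..<x}" using a by auto
      then have "card (D \<inter> {0<..<a}) < card (D \<inter> {0<..<x})"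
        by (intro psubset_card_mono) (use assms(3) in auto)
      then have "f a \<in> dyadic \<longleftrightarrow> a \<in> dyadic"
        using less.hyps[of a] a less.prems by auto
      then show ?thesis using \<open>a \<in> D\<close> assms(4) by auto
    qed
    obtain k :: int where k: "\<And>z. z \<in> {a..x} \<Longrightarrow> f z = f a + 2 powi k * (z - a)"
      using dyadic_slopes_affine[OF assms(1,2) a _ D] less.prems by auto
    have "f x \<in> dyadic \<longleftrightarrow> x - a \<in> dyadic"
      using k[of x] a fa by (simp add: dyadic_add_iff dyadic_powi_mult_iff)
    also have "\<dots> \<longleftrightarrow> x \<in> dyadic"
      using dyadic_add_iff[of a "x - a"] fa by simp
    finally show ?thesis .
  qed
qed

section \<open>Thompson's group is a group\<close>

lemma carrier_thompson_F_iff: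
  "f \<in> carrier thompson_F \<longleftrightarrow>
     f \<in> extensional {0..1} \<and> f ` {0..1} = {0..1} \<and> strict_mono_on {0..1} f \<and>
     continuous_on {0..1} f \<and> (\<exists>D. finite D \<and> D \<subseteq> dyadic \<and> dyadic_slopes D f)"
  unfolding thompson_F_def
  by (auto simp flip: dyadic_slopes_def dest: dyadic_slopes_piecewise_linear)

lemma strict_mono_on_image_unit_zero:
  fixes f :: "real \<Rightarrow> real"
  assumes "strict_mono_on {0..1} f" "f ` {0..1} = {0..1}"
  shows "f 0 = 0"
proof -
  have "0 \<in> f ` {0..1}" using assms(2) by simp
  then obtain x where x: "x \<in> {0..1}" "f x = 0" by (auto simp: image_iff)
  have "f 0 \<in> {0..1}" using assms(2) by (metis atLeastAtMost_iff image_eqI order_refl zero_le_one)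
  then show ?thesis
    using strict_mono_onD[OF assms(1), of 0 x] x by (cases "x = 0") auto
qed

section \<open>Closure under composition and inversion\<close>

lemma compose_mem_thompson_F:
  assumes "f \<in> carrier thompson_F" "g \<in> carrier thompson_F"
  shows "compose {0..1} f g \<in> carrier thompson_F"
proof -
  note f = assms(1)[unfolded carrier_thompson_F_iff]
  note g = assms(2)[unfolded carrier_thompson_F_iff]
  obtain D where D: "finite D" "D \<subseteq> dyadic" "dyadic_slopes D f" using f by blast
  obtain E where E: "finite E" "E \<subseteq> dyadic" "dyadic_slopes E g" using g by blast
  have g_mem: "g x \<in> {0..1}" if "x \<in> {0..1}" for x using g that by blast
  have comp: "compose {0..1} f g x = (f \<circ> g) x" if "x \<in> {0..1}" for x
    using that by (simp add: compose_def)
  \<comment> \<open>By the chain rule the composite can only break where \<open>g\<close> breaks or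
    where \<open>g\<close> hits a breakpoint of \<open>f\<close>. Injectivity of \<open>g\<close>
    keeps the second set finite.\<close>
  define B where "B = E \<union> (g -` D \<inter> {0..1})"
  have "inj_on g {0..1}" using g strict_mono_on_imp_inj_on by blast
  then have "finite B" unfolding B_def using D E by (auto intro: finite_vimage_IntI)
  moreover have "B \<subseteq> dyadic"
  proof -
    have "x \<in> dyadic" if "g x \<in> D" "x \<in> {0..1}" for x
      using dyadic_slopes_dyadic_iff[OF E(3) _ E(1,2) _ that(2)] g that(1) D(2)
        strict_mono_on_image_unit_zero[of g] by blast
    then show ?thesis unfolding B_def using E by auto
  qed
  moreover have "dyadic_slopes B (compose {0..1} f g)"
    unfolding dyadic_slopes_def
  proof
    fix x assume x: "x \<in> {0..1} - B"
    then have "g x \<in> {0..1} - D" "x \<in> {0..1} - E" using g_mem by (auto simp: B_def)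
    then obtain k l :: int where
      "(f has_real_derivative 2 powi k) (at (g x) within {0..1})"
      "(g has_real_derivative 2 powi l) (at x within {0..1})"
      using D(3) E(3) unfolding dyadic_slopes_def by blast
    then have "(f \<circ> g has_real_derivative 2 powi k * 2 powi l) (at x within {0..1})"
      using g by (intro DERIV_image_chain) auto
    \<comment> \<open>The extensional composite agrees with the plain one only on the unit interval,
      which suffices for a derivative within that interval.\<close>
    then have "(compose {0..1} f g has_real_derivative 2 powi (k + l)) (at x within {0..1})"
      using has_field_derivative_transform_within[of "f \<circ> g" _ x "{0..1}" 1] comp x
      by (auto simp: power_int_add)
    then show "\<exists>k::int. (compose {0..1} f g has_real_derivative 2 powi k) (at x within {0..1})" ..
  qed
  moreover have "compose {0..1} f g ` {0..1} = {0..1}"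
    using comp f g by (metis image_comp image_cong)
  moreover have "strict_mono_on {0..1} (compose {0..1} f g)"
    using f g g_mem by (auto simp: strict_mono_on_def compose_def)
  moreover have "continuous_on {0..1} (compose {0..1} f g)"
    using f g comp continuous_on_compose[of "{0..1}" g f] by (metis continuous_on_cong)
  ultimately show ?thesis
    unfolding carrier_thompson_F_iff by auto
qed

lemma restrict_inv_into_mem_thompson_F:
  assumes "f \<in> carrier thompson_F"
  shows "restrict (inv_into {0..1} f) {0..1} \<in> carrier thompson_F"
proof -
  note f = assms[unfolded carrier_thompson_F_iff]
  define g where "g = restrict (inv_into {0..1} f) {0..1}"
  obtain D where D: "finite D" "D \<subseteq> dyadic" "dyadic_slopes D f" using f by blast
  have inj: "inj_on f {0..1}" using f strict_mono_on_imp_inj_on by blast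
  have f_mem: "f x \<in> {0..1}" if "x \<in> {0..1}" for x using f that by blast
  have gf: "g (f x) = x" if "x \<in> {0..1}" for x
    using that f_mem[OF that] inj by (simp add: g_def)
  have preim: "\<exists>x\<in>{0..1}. f x = y" if "y \<in> {0..1}" for y
    using f that by (metis imageE)
  \<comment> \<open>Compactness of the unit interval makes the inverse of a continuous injection
    continuous.\<close>
  have g_cont: "continuous_on {0..1} g"
    using continuous_on_inv[of "{0..1}" f g] f gf by auto
  have "g ` {0..1} = g ` f ` {0..1}" using f by simp
  also have "\<dots> = {0..1}" using gf by (auto simp: image_image)
  finally have "g ` {0..1} = {0..1}" .
  moreover have "strict_mono_on {0..1} g"
  proof (rule strict_mono_onI)
    fix u v :: real assume uv: "u \<in> {0..1}" "v \<in> {0..1}" "u < v"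
    then obtain x y where "x \<in> {0..1}" "y \<in> {0..1}" "f x = u" "f y = v" using preim by metis
    then show "g u < g v"
      using gf f uv strict_mono_on_leD[of "{0..1}" f y x] by force
  qed
  \<comment> \<open>The inverse breaks at the images of the breakpoints of \<open>f\<close>. The
    intersection is taken because \<open>D\<close> may contain dyadics outside the unit interval,
    where \<open>f\<close> is \<open>undefined\<close>.\<close>
  moreover have "dyadic_slopes (f ` (D \<inter> {0..1})) g"
    unfolding dyadic_slopes_def
  proof
    fix y assume y: "y \<in> {0..1} - f ` (D \<inter> {0..1})"
    then obtain x where x: "x \<in> {0..1} - D" "f x = y" using preim by force
    then obtain k :: int where k: "(f has_real_derivative 2 powi k) (at x within {0..1})"
      using D(3) unfolding dyadic_slopes_def by blast
    have "(g has_derivative (*) (2 powi (- k))) (at (f x) within f ` {0..1})"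
    proof (rule has_derivative_inverse_within)
      show "(f has_derivative (*) (2 powi k)) (at x within {0..1})"
        using k by (simp add: has_field_derivative_def)
      show "continuous (at (f x) within f ` {0..1}) g"
        using g_cont f x y by (auto simp: continuous_on_eq_continuous_within)
      show "linear ((*) (2 powi (- k) :: real))"
        by (simp add: linear_times)
      show "(*) (2 powi (- k) :: real) \<circ> (*) (2 powi k) = id"
        by (auto simp: power_int_minus)
    qed (use x gf in auto)
    then have "(g has_real_derivative 2 powi (- k)) (at y within {0..1})"
      using f x by (simp add: has_field_derivative_def)
    then show "\<exists>k::int. (g has_real_derivative 2 powi k) (at y within {0..1})" ..
  qed
  moreover have "f ` (D \<inter> {0..1}) \<subseteq> dyadic"
    using dyadic_slopes_dyadic_iff[OF D(3) _ D(1,2)] f D(2) strict_mono_on_image_unit_zero[of f]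
    by blast
  ultimately show ?thesis
    unfolding g_def[symmetric] carrier_thompson_F_iff
    using g_cont D(1) by (intro conjI exI[of _ "f ` (D \<inter> {0..1})"]) (auto simp: g_def)
qed

lemma thompson_F_Bij: "f \<in> carrier thompson_F \<Longrightarrow> f \<in> Bij {0..1}"
  by (auto simp: carrier_thompson_F_iff Bij_def bij_betw_def strict_mono_on_imp_inj_on)

lemma subgroup_thompson_F: "subgroup (carrier thompson_F) (BijGroup {0..1})"
proof -
  interpret B: group "BijGroup {0..1::real}" by (rule group_BijGroup)
  have inv_eq: "inv\<^bsub>BijGroup {0..1}\<^esub> f = restrict (inv_into {0..1} f) {0..1}"
    if "f \<in> carrier thompson_F" for f
    using thompson_F_Bij[OF that] by (rule inv_BijGroup)
  show ?thesis
  proof (rule subgroup.intro)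
    show "carrier thompson_F \<subseteq> carrier (BijGroup {0..1})"
      using thompson_F_Bij by (auto simp: BijGroup_def)
    show "f \<otimes>\<^bsub>BijGroup {0..1}\<^esub> g \<in> carrier thompson_F"
      if "f \<in> carrier thompson_F" "g \<in> carrier thompson_F" for f g
      using that thompson_F_Bij compose_mem_thompson_F by (simp add: BijGroup_def)
    have "dyadic_slopes {} (\<lambda>x\<in>{0..1}. x)"
      unfolding dyadic_slopes_def
    proof
      fix x :: real assume "x \<in> {0..1} - {}"
      then have "((\<lambda>x\<in>{0..1}. x) has_real_derivative 2 powi 0) (at x within {0..1})"
        using has_field_derivative_transform_within[of "\<lambda>x. x" 1 x "{0..1}" 1 "\<lambda>x\<in>{0..1}. x"]
        by simp
      then show "\<exists>k::int. ((\<lambda>x\<in>{0..1}. x) has_real_derivative 2 powi k) (at x within {0..1})" ..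
    qed
    moreover have "continuous_on {0..1} (\<lambda>x\<in>{0..1::real}. x)"
      by (rule continuous_on_eq[of _ "\<lambda>x. x"]) auto
    ultimately have "(\<lambda>x\<in>{0..1}. x) \<in> carrier thompson_F"
      unfolding carrier_thompson_F_iff by (auto simp: strict_mono_on_def)
    then show "\<one>\<^bsub>BijGroup {0..1}\<^esub> \<in> carrier thompson_F"
      by (simp add: BijGroup_def)
    show "inv\<^bsub>BijGroup {0..1}\<^esub> f \<in> carrier thompson_F" if "f \<in> carrier thompson_F" for f
      unfolding inv_eq[OF that] using that by (rule restrict_inv_into_mem_thompson_F)
  qed
qed

text \<open>Brings the record update in the definition into the shape that
  \<open>subgroup.subgroup_is_group\<close> produces, so the group axioms are inherited from
  \<open>BijGroup\<close>.\<close>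

lemma thompson_F_eq: "thompson_F = (BijGroup {0..1}) \<lparr>carrier := carrier thompson_F\<rparr>"
  by (simp add: thompson_F_def)

lemma group_thompson_F: "group thompson_F"
  using subgroup.subgroup_is_group[OF subgroup_thompson_F group_BijGroup] thompson_F_eq by simp

section \<open>Pointwise computation in Thompson's group\<close>

lemma thompson_F_mult_apply:
  assumes "f \<in> carrier thompson_F" "g \<in> carrier thompson_F" "x \<in> {0..1}"
  shows "(f \<otimes>\<^bsub>thompson_F\<^esub> g) x = f (g x)"
  by (subst thompson_F_eq)
     (use assms thompson_F_Bij in \<open>simp add: BijGroup_def compose_eq\<close>)

lemma thompson_F_one_apply: "x \<in> {0..1} \<Longrightarrow> \<one>\<^bsub>thompson_F\<^esub> x = x"
  by (simp add: thompson_F_def BijGroup_def)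

lemma thompson_F_apply_mem: "f \<in> carrier thompson_F \<Longrightarrow> x \<in> {0..1} \<Longrightarrow> f x \<in> {0..1}"
  unfolding carrier_thompson_F_iff by blast

lemma thompson_F_strict_mono: "f \<in> carrier thompson_F \<Longrightarrow> strict_mono_on {0..1} f"
  unfolding carrier_thompson_F_iff by blast

lemma thompson_F_eqI:
  assumes "f \<in> carrier thompson_F" "g \<in> carrier thompson_F"
    and "\<And>x. x \<in> {0..1} \<Longrightarrow> f x = g x"
  shows "f = g"
  using assms by (intro extensionalityI[of f "{0..1}"]) (auto simp: carrier_thompson_F_iff)

section \<open>Evaluation of words\<close>

text \<open>Naming the alphabet lets inductions over words treat one letter at a time.\<close>

definition letters :: "('a, 'b) monoid_scheme \<Rightarrow> nat \<Rightarrow> 'a letter set" where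
  "letters G t = Const ` carrier G \<union> {Var i e | i e. i < t}"

lemma cwords_eq: "cwords G t = lists (letters G t)"
  by (simp add: cwords_def letters_def)

context group
begin

section \<open>Values of words under concatenation and inversion\<close>

lemma letter_val_closed:
  "l \<in> letters G t \<Longrightarrow> (\<And>i. i < t \<Longrightarrow> \<rho> i \<in> carrier G) \<Longrightarrow> letter_val G \<rho> l \<in> carrier G"
  by (auto simp: letters_def)

lemma word_val_closed:
  "w \<in> cwords G t \<Longrightarrow> (\<And>i. i < t \<Longrightarrow> \<rho> i \<in> carrier G) \<Longrightarrow> word_val G \<rho> w \<in> carrier G"
  unfolding cwords_eq
  by (induction w) (auto simp: word_val_def letter_val_closed)

lemma word_val_Cons: "word_val G \<rho> (l # w) = letter_val G \<rho> l \<otimes> word_val G \<rho> w"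
  by (simp add: word_val_def)

lemma word_val_append:
  assumes "v \<in> cwords G t" "w \<in> cwords G t" "\<And>i. i < t \<Longrightarrow> \<rho> i \<in> carrier G"
  shows "word_val G \<rho> (v @ w) = word_val G \<rho> v \<otimes> word_val G \<rho> w"
  using assms(1)
proof (induction v)
  case Nil
  then show ?case using word_val_closed[OF assms(2,3)] by (simp add: word_val_def)
next
  case (Cons l v)
  then have "l \<in> letters G t" "v \<in> cwords G t" by (auto simp: cwords_eq)
  then show ?case
    using Cons.IH letter_val_closed[OF _ assms(3)] word_val_closed[OF _ assms(3)] assms(2)
    by (simp add: word_val_Cons m_assoc)
qed

lemma letter_inv_mem: "l \<in> letters G t \<Longrightarrow> letter_inv G l \<in> letters G t"
  by (auto simp: letters_def)

lemma word_inv_mem: "w \<in> cwords G t \<Longrightarrow> word_inv G w \<in> cwords G t"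
  by (auto simp: word_inv_def cwords_eq in_lists_conv_set letter_inv_mem)

lemma word_comm_mem:
  "v \<in> cwords G t \<Longrightarrow> w \<in> cwords G t \<Longrightarrow> word_comm G v w \<in> cwords G t"
  using word_inv_mem[of v t] word_inv_mem[of w t]
  by (simp add: word_comm_def cwords_eq)

lemma word_conj_mem:
  "v \<in> cwords G t \<Longrightarrow> w \<in> cwords G t \<Longrightarrow> word_conj G v w \<in> cwords G t"
  using word_inv_mem[of w t]
  by (simp add: word_conj_def cwords_eq)

lemma word_val_word_inv:
  assumes "w \<in> cwords G t" and \<rho>: "\<And>i. i < t \<Longrightarrow> \<rho> i \<in> carrier G"
  shows "word_val G \<rho> (word_inv G w) = inv (word_val G \<rho> w)"
  using assms(1)
proof (induction w)
  case Nil
  then show ?case by (simp add: word_val_def word_inv_def)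
next
  case (Cons l w)
  then have l: "l \<in> letters G t" and w: "w \<in> cwords G t" by (auto simp: cwords_eq)
  have "[letter_inv G l] \<in> cwords G t" using letter_inv_mem[OF l] by (simp add: cwords_eq)
  then have "word_val G \<rho> (word_inv G (l # w)) =
      word_val G \<rho> (word_inv G w) \<otimes> word_val G \<rho> [letter_inv G l]"
    using word_val_append[OF word_inv_mem[OF w] _ \<rho>] by (simp add: word_inv_def)
  also have "word_val G \<rho> [letter_inv G l] = inv (letter_val G \<rho> l)"
    using l \<rho> by (auto simp: letters_def word_val_def)
  finally show ?case
    using Cons.IH[OF w] letter_val_closed[OF l \<rho>] word_val_closed[OF w \<rho>]
    by (simp add: word_val_Cons inv_mult_group)
qed

section \<open>Invariance of values under reduction\<close>

lemma prepend_mem: "l \<in> letters G t \<Longrightarrow> w \<in> cwords G t \<Longrightarrow> prepend G l w \<in> cwords G t"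
  by (cases l) (auto simp: cwords_eq letters_def split: list.splits letter.splits)

lemma word_val_prepend:
  assumes "l \<in> letters G t" "w \<in> cwords G t" and \<rho>: "\<And>i. i < t \<Longrightarrow> \<rho> i \<in> carrier G"
  shows "word_val G \<rho> (prepend G l w) = letter_val G \<rho> l \<otimes> word_val G \<rho> w"
proof (cases w)
  case Nil
  then show ?thesis using assms by (cases l) (auto simp: word_val_def letters_def)
next
  case (Cons m v)
  then have m: "m \<in> letters G t" and v: "v \<in> cwords G t" using assms(2) by (auto simp: cwords_eq)
  \<comment> \<open>Reassociating brings the first two letters together: these are the only letters
    that \<open>prepend\<close> can merge or cancel.\<close>
  have "letter_val G \<rho> l \<otimes> word_val G \<rho> w = (letter_val G \<rho> l \<otimes> letter_val G \<rho> m) \<otimes> word_val G \<rho> v"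
    using Cons letter_val_closed[OF assms(1) \<rho>] letter_val_closed[OF m \<rho>] word_val_closed[OF v \<rho>]
    by (simp add: word_val_Cons m_assoc)
  moreover note word_val_closed[OF v \<rho>] word_val_closed[OF assms(2) \<rho>]
  ultimately show ?thesis
    using Cons assms(1) m \<rho>
    by (cases l; cases m) (auto simp: word_val_Cons letters_def)
qed

lemma reduce_mem: "w \<in> cwords G t \<Longrightarrow> reduce G w \<in> cwords G t"
  unfolding reduce_def by (induction w) (auto simp: cwords_eq prepend_mem[unfolded cwords_eq])

lemma word_val_reduce:
  assumes "w \<in> cwords G t" and \<rho>: "\<And>i. i < t \<Longrightarrow> \<rho> i \<in> carrier G"
  shows "word_val G \<rho> (reduce G w) = word_val G \<rho> w"
  using assms(1)
proof (induction w)
  case Nil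
  then show ?case by (simp add: reduce_def)
next
  case (Cons l w)
  then have "l \<in> letters G t" and w: "w \<in> cwords G t" by (auto simp: cwords_eq)
  then show ?case
    using word_val_prepend[OF _ reduce_mem[OF w] \<rho>, of l] Cons.IH
    by (simp add: reduce_def word_val_Cons)
qed

section \<open>Values of commutators and conjugates\<close>

lemma word_val_word_comm_eq_one:
  assumes vw: "v \<in> cwords G t" "w \<in> cwords G t" and \<rho>: "\<And>i. i < t \<Longrightarrow> \<rho> i \<in> carrier G"
    and comm: "word_val G \<rho> v \<otimes> word_val G \<rho> w = word_val G \<rho> w \<otimes> word_val G \<rho> v"
  shows "word_val G \<rho> (word_comm G v w) = \<one>"
proof -
  note closed = word_val_closed[OF vw(1) \<rho>] word_val_closed[OF vw(2) \<rho>]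
  have "v @ w \<in> cwords G t" "word_inv G w @ v @ w \<in> cwords G t"
    using vw word_inv_mem[OF vw(2)] by (auto simp: cwords_eq)
  then have "word_val G \<rho> (word_comm G v w) =
      inv (word_val G \<rho> v) \<otimes> (inv (word_val G \<rho> w) \<otimes> (word_val G \<rho> v \<otimes> word_val G \<rho> w))"
    using vw \<rho> by (simp add: word_comm_def word_val_append[OF _ _ \<rho>, where t = t]
      word_val_word_inv[OF _ \<rho>, where t = t] word_inv_mem)
  also have "\<dots> = \<one>"
    unfolding comm using closed by (simp flip: m_assoc)
  finally show ?thesis .
qed

lemma word_val_word_conj:
  assumes vw: "v \<in> cwords G t" "w \<in> cwords G t" and \<rho>: "\<And>i. i < t \<Longrightarrow> \<rho> i \<in> carrier G"
  shows "word_val G \<rho> (word_conj G v w) =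
    inv (word_val G \<rho> w) \<otimes> (word_val G \<rho> v \<otimes> word_val G \<rho> w)"
proof -
  have "v @ w \<in> cwords G t" using vw by (auto simp: cwords_eq)
  then show ?thesis
    using vw \<rho> by (simp add: word_conj_def word_val_append[OF _ _ \<rho>, where t = t]
      word_val_word_inv[OF _ \<rho>, where t = t] word_inv_mem)
qed

text \<open>The only cancellation in the unreduced commutator is in its middle, where
  \<open>h\<^sub>2\<close> and the inverse of \<open>h\<^sub>1\<close> are multiplied.\<close>

lemma reduce_word_comm_word_comm:
  assumes "a \<in> carrier G" "b \<in> carrier G" "c \<in> carrier G" "d \<in> carrier G"
    and "a \<noteq> \<one>" "b \<noteq> \<one>" "c \<noteq> \<one>" "d \<noteq> \<one>" and "a \<noteq> b"
  shows "reduce G (word_comm G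
      (word_comm G (word_conj G [Const a] [Var i True]) [Const d])
      (word_comm G (word_conj G [Const b] [Var i True]) [Const c])) =
    [Const (inv d), Var i False, Const (inv a), Var i True, Const d, Var i False, Const a,
     Var i True, Const (inv c), Var i False, Const (inv b), Var i True, Const c, Var i False,
     Const (b \<otimes> inv a), Var i True, Const (inv d), Var i False, Const a, Var i True, Const d,
     Var i False, Const (inv b), Var i True, Const (inv c), Var i False, Const b, Var i True,
     Const c]"
proof -
  \<comment> \<open>This is where \<open>a \<noteq> b\<close> enters. If the middle constant were
    trivial, the inverse variable before it would cancel with the variable after it, and
    \<open>c\<close> would then merge with \<open>inv d\<close>.\<close>
  have "b \<otimes> inv a \<noteq> \<one>" using assms by (metis inv_closed inv_equality inv_inv)
  then show ?thesis
    using assms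
    unfolding word_comm_conj_letters
    by (simp add: word_comm_def word_inv_def reduce_def inv_eq_1_iff)
qed

end

section \<open>Supports\<close>

interpretation F: group thompson_F
  by (rule group_thompson_F)

text \<open>An injective map that moves a point also moves its image. So where \<open>f\<close>
  moves \<open>x\<close>, \<open>g\<close> fixes both \<open>x\<close> and \<open>f x\<close>; where
  \<open>f\<close> fixes \<open>x\<close>, either \<open>f\<close> fixes \<open>g x\<close>, or
  \<open>g\<close> fixes \<open>g x\<close> and hence \<open>x\<close>.\<close>

lemma thompson_F_commute:
  assumes f: "f \<in> carrier thompson_F" and g: "g \<in> carrier thompson_F"
    and disj: "\<And>x. x \<in> {0..1} \<Longrightarrow> f x = x \<or> g x = x"
  shows "f \<otimes>\<^bsub>thompson_F\<^esub> g = g \<otimes>\<^bsub>thompson_F\<^esub> f"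
proof (rule thompson_F_eqI)
  fix x :: real assume x: "x \<in> {0..1}"
  have inj: "inj_on k {0..1}" if "k \<in> carrier thompson_F" for k
    using thompson_F_strict_mono[OF that] by (rule strict_mono_on_imp_inj_on)
  have "f (g x) = g (f x)"
  proof (cases "f x = x")
    case True
    then have "f (g x) = g x"
      using disj[OF thompson_F_apply_mem[OF g x]] inj_onD[OF inj[OF g], of "g x" x]
        x thompson_F_apply_mem[OF g x] by metis
    then show ?thesis using True by simp
  next
    case False
    then have "g (f x) = f x" "g x = x"
      using disj[OF thompson_F_apply_mem[OF f x]] inj_onD[OF inj[OF f], of "f x" x]
        x thompson_F_apply_mem[OF f x] disj[OF x] by metis+
    then show ?thesis by simp
  qed
  then show "(f \<otimes>\<^bsub>thompson_F\<^esub> g) x = (g \<otimes>\<^bsub>thompson_F\<^esub> f) x"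
    using f g x by (simp add: thompson_F_mult_apply)
qed (use f g in auto)

text \<open>Serves to show that \<open>h 1\<close> and \<open>h 2\<close> differ, as the computation
  of the reduced word requires.\<close>

lemma thompson_F_on_trivial:
  assumes "f \<in> thompson_F_on I" "f \<in> thompson_F_on J" "I \<inter> J = {}"
  shows "f = \<one>\<^bsub>thompson_F\<^esub>"
proof (rule thompson_F_eqI)
  fix x :: real assume "x \<in> {0..1}"
  then show "f x = \<one>\<^bsub>thompson_F\<^esub> x"
    using assms by (cases "x \<in> I") (auto simp: thompson_F_on_def thompson_F_one_apply disjoint_iff)
qed (use assms in \<open>auto simp: thompson_F_on_def\<close>)

lemma thompson_F_conj_fixes:
  assumes "f \<in> thompson_F_on I" "g \<in> carrier thompson_F" "x \<in> {0..1}" "g x \<notin> I"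
  shows "(inv\<^bsub>thompson_F\<^esub> g \<otimes>\<^bsub>thompson_F\<^esub> (f \<otimes>\<^bsub>thompson_F\<^esub> g)) x = x"
proof -
  have f: "f \<in> carrier thompson_F" using assms by (simp add: thompson_F_on_def)
  have gx: "g x \<in> {0..1}" using thompson_F_apply_mem assms by blast
  then have "f (g x) = g x" using assms by (simp add: thompson_F_on_def)
  then have "(inv\<^bsub>thompson_F\<^esub> g \<otimes>\<^bsub>thompson_F\<^esub> (f \<otimes>\<^bsub>thompson_F\<^esub> g)) x
      = (inv\<^bsub>thompson_F\<^esub> g) (g x)"
    using f assms gx by (simp add: thompson_F_mult_apply)
  also have "\<dots> = (inv\<^bsub>thompson_F\<^esub> g \<otimes>\<^bsub>thompson_F\<^esub> g) x"
    by (rule thompson_F_mult_apply[symmetric]) (use assms in auto)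
  also have "\<dots> = x" using assms by (simp add: thompson_F_one_apply)
  finally show ?thesis .
qed

text \<open>By \<open>sep\<close>, the preimage of \<open>I\<close> under \<open>\<rho> i\<close>,
  which supports the conjugate of \<open>f\<close>, misses \<open>J\<close>, which supports
  \<open>k\<close>; so the two commute. The contrapositive yields a point of \<open>J\<close> sent
  into \<open>I\<close>.\<close>

lemma word_val_comm_conj_trivial:
  assumes f: "f \<in> thompson_F_on I" and k: "k \<in> thompson_F_on J"
    and "i < t" and \<rho>: "\<And>j. j < t \<Longrightarrow> \<rho> j \<in> carrier thompson_F"
    and sep: "\<And>x. x \<in> J \<inter> {0..1} \<Longrightarrow> \<rho> i x \<notin> I"
  shows "word_val thompson_F \<rho>
    (word_comm thompson_F (word_conj thompson_F [Const f] [Var i True]) [Const k]) =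
    \<one>\<^bsub>thompson_F\<^esub>"
proof -
  have fk: "f \<in> carrier thompson_F" "k \<in> carrier thompson_F"
    using f k by (simp_all add: thompson_F_on_def)
  then have mem: "[Const f] \<in> cwords thompson_F t" "[Const k] \<in> cwords thompson_F t"
    "[Var i True] \<in> cwords thompson_F t"
    using \<open>i < t\<close> by (auto simp: cwords_eq letters_def)
  let ?c = "inv\<^bsub>thompson_F\<^esub> \<rho> i \<otimes>\<^bsub>thompson_F\<^esub> (f \<otimes>\<^bsub>thompson_F\<^esub> \<rho> i)"
  have conj: "word_val thompson_F \<rho> (word_conj thompson_F [Const f] [Var i True]) = ?c"
    using F.word_val_word_conj[where \<rho> = \<rho>, OF mem(1,3) \<rho>] fk \<rho>[OF \<open>i < t\<close>]
    by (simp add: word_val_def)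
  have "?c \<otimes>\<^bsub>thompson_F\<^esub> k = k \<otimes>\<^bsub>thompson_F\<^esub> ?c"
  proof (rule thompson_F_commute)
    fix x :: real assume x: "x \<in> {0..1}"
    show "?c x = x \<or> k x = x"
    proof (cases "x \<in> J")
      case True
      then show ?thesis using thompson_F_conj_fixes[OF f \<rho>[OF \<open>i < t\<close>] x] sep x by blast
    next
      case False
      then show ?thesis using k x by (simp add: thompson_F_on_def)
    qed
  qed (use fk \<rho> \<open>i < t\<close> in auto)
  moreover have "word_val thompson_F \<rho> [Const k] = k"
    using fk by (simp add: word_val_def)
  ultimately show ?thesis
    using conj by (intro F.word_val_word_comm_eq_one[OF F.word_conj_mem[OF mem(1,3)] mem(2) \<rho>]) simp_all
qed

theorem proposition4p4:
  fixes p q :: "nat \<Rightarrow> real" and h :: "nat \<Rightarrow> real \<Rightarrow> real"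
    and y w14 w23 :: "(real \<Rightarrow> real) cword"
  assumes "\<And>i. i \<in> {1..4} \<Longrightarrow> p i \<in> dyadic \<and> q i \<in> dyadic \<and> 0 \<le> p i \<and> p i < q i \<and> q i \<le> 1"
    and "disjoint_family_on (\<lambda>i. {p i..q i}) {1..4}"
    and "p 1 < p 2" and "p 2 < p 3" and "p 3 < p 4"
    and "\<And>i. i \<in> {1..4} \<Longrightarrow> h i \<in> thompson_F_on {p i..q i} \<and> h i \<noteq> \<one>\<^bsub>thompson_F\<^esub>"
  defines "y \<equiv> [Var 0 True]"
  defines "w14 \<equiv> word_comm thompson_F (word_conj thompson_F [Const (h 1)] y) [Const (h 4)]"
    and "w23 \<equiv> word_comm thompson_F (word_conj thompson_F [Const (h 2)] y) [Const (h 3)]"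
  shows "law_with_constants thompson_F 1
           (reduce thompson_F (word_comm thompson_F w14 w23))"
proof -
  let ?w = "word_comm thompson_F w14 w23"
  have h: "h i \<in> carrier thompson_F" "h i \<in> thompson_F_on {p i..q i}" "h i \<noteq> \<one>\<^bsub>thompson_F\<^esub>"
    if "i \<in> {1..4}" for i
    using assms(6)[OF that] by (auto simp: thompson_F_on_def)
  have disj: "{p i..q i} \<inter> {p j..q j} = {}" if "i \<in> {1..4}" "j \<in> {1..4}" "i \<noteq> j" for i j
    using assms(2) that by (rule disjoint_family_onD)
  \<comment> \<open>Disjointness upgrades the order of left endpoints to an order of whole
    intervals: otherwise \<open>p j\<close> would lie in both.\<close>
  have sep: "q i < p j" if "i \<in> {1..4}" "j \<in> {1..4}" "p i < p j" for i j
  proof (rule ccontr)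
    assume "\<not> q i < p j"
    then have "p j \<in> {p i..q i} \<inter> {p j..q j}" using assms(1)[OF that(2)] that(3) by auto
    then show False using disj[of i j] that by auto
  qed
  have mem_y: "y \<in> cwords thompson_F 1" by (auto simp: y_def cwords_eq letters_def)
  have mem_h: "[Const (h i)] \<in> cwords thompson_F 1" if "i \<in> {1..4}" for i
    using h[OF that] by (simp add: cwords_eq letters_def)
  have mem: "w14 \<in> cwords thompson_F 1" "w23 \<in> cwords thompson_F 1"
    unfolding w14_def w23_def
    by (intro F.word_comm_mem F.word_conj_mem mem_y mem_h; simp)+
  have mem_w: "?w \<in> cwords thompson_F 1" using mem by (rule F.word_comm_mem)
  have "h 1 \<noteq> h 2"
  proof
    assume "h 1 = h 2"
    then have "h 1 = \<one>\<^bsub>thompson_F\<^esub>"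
      using h(2)[of 1] h(2)[of 2] disj[of 1 2] thompson_F_on_trivial[of "h 1"] by auto
    then show False using h(3)[of 1] by simp
  qed
  \<comment> \<open>The first two letters are enough: they show that the reduced word is nonempty
    and contains both a constant and a variable.\<close>
  then have form: "\<exists>e v. reduce thompson_F ?w = Const (inv\<^bsub>thompson_F\<^esub> h 4) # Var 0 e # v"
    unfolding w14_def w23_def y_def
    by (subst F.reduce_word_comm_word_comm) (use h in auto)
  have "word_val thompson_F \<rho> (reduce thompson_F ?w) = \<one>\<^bsub>thompson_F\<^esub>"
    if "\<forall>i<1. \<rho> i \<in> carrier thompson_F" for \<rho>
  proof -
    have \<rho>: "\<And>i. i < 1 \<Longrightarrow> \<rho> i \<in> carrier thompson_F" using that by blast
    have "word_val thompson_F \<rho> w14 = \<one>\<^bsub>thompson_F\<^esub> \<or> word_val thompson_F \<rho> w23 = \<one>\<^bsub>thompson_F\<^esub>"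
    proof (rule ccontr)
      assume "\<not> ?thesis"
      then have ne: "word_val thompson_F \<rho> w14 \<noteq> \<one>\<^bsub>thompson_F\<^esub>"
        "word_val thompson_F \<rho> w23 \<noteq> \<one>\<^bsub>thompson_F\<^esub>"
        by simp_all
      \<comment> \<open>If no such point existed, the separation hypothesis of
        \<open>word_val_comm_conj_trivial\<close> would hold and \<open>w14\<close> would have
        trivial value.\<close>
      obtain a where a: "a \<in> {p 4..q 4} \<inter> {0..1}" "\<rho> 0 a \<in> {p 1..q 1}"
        using ne(1) word_val_comm_conj_trivial[OF h(2)[of 1] h(2)[of 4] zero_less_one \<rho>]
        unfolding w14_def y_def by fastforce
      obtain b where b: "b \<in> {p 3..q 3} \<inter> {0..1}" "\<rho> 0 b \<in> {p 2..q 2}"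
        using ne(2) word_val_comm_conj_trivial[OF h(2)[of 2] h(2)[of 3] zero_less_one \<rho>]
        unfolding w23_def y_def by fastforce
      note ab = a b
      have "b < a" using ab sep[of 3 4] assms(5) by auto
      then have "\<rho> 0 b < \<rho> 0 a"
        using thompson_F_strict_mono[OF \<rho>, of 0] ab by (auto simp: strict_mono_on_def)
      moreover have "\<rho> 0 a < \<rho> 0 b" using ab sep[of 1 2] assms(3) by auto
      ultimately show False by simp
    qed
    \<comment> \<open>A trivial value commutes with the other one, so the outer commutator evaluates
      to the identity whichever of the two is trivial.\<close>
    then have "word_val thompson_F \<rho> ?w = \<one>\<^bsub>thompson_F\<^esub>"
      using F.word_val_closed[where \<rho> = \<rho>, OF mem(1) \<rho>] F.word_val_closed[where \<rho> = \<rho>, OF mem(2) \<rho>]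
      by (intro F.word_val_word_comm_eq_one[OF mem \<rho>]) auto
    then show ?thesis using F.word_val_reduce[where \<rho> = \<rho>, OF mem_w \<rho>] by simp
  qed
  then show ?thesis
    unfolding law_with_constants_def
    using F.reduce_mem[OF mem_w] reduced_reduce[of thompson_F ?w] form
    by (metis list.distinct(1) list.set_intros)
qed

end
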